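(* Let $A:L^1(\Omega)\to L^\infty(\Gamma)$, $f$, $R$, $H_f$, $u^\dagger$ and $u_\alpha$ ($\alpha>0$) be as in the context. Assume that $Au_\alpha\in E$ for any $\alpha>0$, and that there exists a positive constant $m$ such that $m\le\inf\{\operatorname{ess\,inf}Au_\alpha:\alpha>0,\ \alpha\text{ sufficiently small}\}$. Assume moreover that there exist $p^\dagger\in L^\infty(\Gamma)$ satisfying $A^*p^\dagger\in\partial R(u^\dagger)$ and a strictly increasing, continuous, concave function $\Phi:[0,+\infty)\to[0,+\infty)$ with $\Phi(0)=0$ such that the following variational source condition holds: $$\forall p\in L^\infty(\Gamma),\qquad\int_\Gamma f(t)p^\dagger(t)\,(p^\dagger(t)-p(t))\,dt\le\Phi\big(D_{R^*}(A^*p,A^*p^\dagger)\big).$$ Then the following holds: $$D_R(u_\alpha,u^\dagger)\le2\Psi(\alpha)+\Phi^{-1}\left(\alpha^2\,\frac{\Vert f(p^\dagger)^2\Vert_2^2}{4\gamma}\right),$$ where $\Psi$ is the convex conjugate of the convex mapping $t\mapsto\Phi^{-1}(t)$ and $\gamma=\frac{2m}{3}$.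
   Context: $\Omega,\Gamma\subset\mathbb{R}^2$ are bounded measurable sets. $A:L^1(\Omega)\to L^\infty(\Gamma)$ is linear, compact and ill-posed (i.e. the equation $Au=f$ is ill-posed). The data $f\in L^\infty(\Gamma)$ satisfy $c_1\le f(t)\le c_2$ for a.e. $t\in\Gamma$, for some constants $c_1,c_2>0$. The data fidelity is the Kullback-Leibler functional $H_f:L^\infty(\Gamma)\to[0,+\infty]$, $H_f(z)=\int_\Gamma\varphi_f(t,z(t))\,dt$ if $\varphi_f(\cdot,z(\cdot))\in L^1(\Gamma)$ and $H_f(z)=+\infty$ otherwise, where $\varphi_f(t,\tau)=f(t)\ln\frac{f(t)}{\tau}-f(t)+\tau$ for $\tau>0$ and $\varphi_f(t,\tau)=+\infty$ for $\tau\le0$. $R:L^1(\Omega)\to\mathbb{R}\cup\{+\infty\}$ is proper, convex and lower semicontinuous, with Fenchel conjugate $R^*$. $u^\dagger\in\operatorname{arg\,min}\{R(u):Au=f\}$. For each $\alpha>0$ it is assumed that a minimizer $u_\alpha$ of $\frac1\alpha H_f(Au)+R(u)$ over $u\in L^1(\Omega)$ exists, and that there is $u_0\in\operatorname{dom}(H_f\circ A)\cap\operatorname{dom}R$ such that $H_f$ is continuous at $Au_0$. $E=\{v\in L^1(\Gamma):0<\operatorname{ess\,inf}v\le\operatorname{ess\,sup}v<+\infty\}$. An element $p\in L^\infty(\Gamma)$ is regarded as the element $z\mapsto\int_\Gamma pz\,dt$ of $(L^\infty(\Gamma))^*$. Products and powers of functions are pointwise; $\Vert\cdot\Vert_2$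 is the $L^2(\Gamma)$-norm. Bregman distances: $D_R(u,u^\dagger)=R(u)-R(u^\dagger)-\langle A^*p^\dagger,u-u^\dagger\rangle$ and $D_{R^*}(A^*p,A^*p^\dagger)=R^*(A^*p)-R^*(A^*p^\dagger)-\langle u^\dagger,A^*p-A^*p^\dagger\rangle$ (note $u^\dagger\in\partial R^*(A^*p^\dagger)$). The right-hand side of the variational source condition is read as $+\infty$ when $D_{R^*}(A^*p,A^*p^\dagger)=+\infty$. $\Phi^{-1}$ is extended by $+\infty$ outside the range of $\Phi$, and $\Psi(\alpha)=\sup_{t\ge0}\{\alpha t-\Phi^{-1}(t)\}$.
   Formalization: The estimate is proved for all sufficiently small α>0 (threshold may depend on the data), matching the assumption on m; for all α>0 it is false, e.g. for Au=(∫u)·1, f=1, p†=−1, R(u)=r(∫u) with a suitable convex r and α=2. *)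

theory Defs
  imports "HOL-Analysis.Analysis" "HOL-Probability.Essential_Supremum"
begin

text \<open>
  Elements of $L^1$ and $L^\infty$ are represented by functions; equality of classes is equality
  almost everywhere, and every operator below is required to respect it where this does not follow.
  The measure is Lebesgue measure restricted to a set, \<^term>\<open>lebesgue_on S\<close>.
\<close>

definition L1 :: "'a measure \<Rightarrow> ('a \<Rightarrow> real) set" where
  "L1 M = {u. integrable M u}"

definition norm_1 :: "'a measure \<Rightarrow> ('a \<Rightarrow> real) \<Rightarrow> real" where
  "norm_1 M u = (\<integral>t. \<bar>u t\<bar> \<partial>M)"

definition norm_2 :: "'a measure \<Rightarrow> ('a \<Rightarrow> real) \<Rightarrow> real" where
  "norm_2 M u = sqrt (\<integral>t. (u t)\<^sup>2 \<partial>M)"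

definition Linf :: "'a measure \<Rightarrow> ('a \<Rightarrow> real) set" where
  "Linf M = {z \<in> borel_measurable M. esssup M (\<lambda>t. ereal \<bar>z t\<bar>) < \<infinity>}"

text \<open>On a null space the essential supremum is \<^term>\<open>- \<infinity> :: ereal\<close>, so the norm is then \<open>0\<close>.\<close>

definition norm_inf :: "'a measure \<Rightarrow> ('a \<Rightarrow> real) \<Rightarrow> real" where
  "norm_inf M z = real_of_ereal (esssup M (\<lambda>t. ereal \<bar>z t\<bar>))"

definition ess_sup :: "'a measure \<Rightarrow> ('a \<Rightarrow> real) \<Rightarrow> ereal" where
  "ess_sup M v = esssup M (\<lambda>t. ereal (v t))"

definition ess_inf :: "'a measure \<Rightarrow> ('a \<Rightarrow> real) \<Rightarrow> ereal" where
  "ess_inf M v = - esssup M (\<lambda>t. - ereal (v t))"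

definition E_set :: "'a measure \<Rightarrow> ('a \<Rightarrow> real) set" where
  "E_set M = {v \<in> L1 M. 0 < ess_inf M v \<and> ess_inf M v \<le> ess_sup M v \<and> ess_sup M v < \<infinity>}"


definition linear_operator ::
    "'a measure \<Rightarrow> 'b measure \<Rightarrow> (('a \<Rightarrow> real) \<Rightarrow> ('b \<Rightarrow> real)) \<Rightarrow> bool" where
  "linear_operator M N A \<longleftrightarrow>
     (\<forall>u\<in>L1 M. A u \<in> Linf N) \<and>
     (\<forall>u\<in>L1 M. \<forall>v\<in>L1 M. (AE t in M. u t = v t) \<longrightarrow> (AE t in N. A u t = A v t)) \<and>
     (\<forall>u\<in>L1 M. \<forall>v\<in>L1 M. AE t in N. A (\<lambda>s. u s + v s) t = A u t + A v t) \<and>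
     (\<forall>u\<in>L1 M. \<forall>c. AE t in N. A (\<lambda>s. c * u s) t = c * A u t)"

text \<open>The image of the closed unit ball is relatively (sequentially) compact.\<close>

definition compact_operator ::
    "'a measure \<Rightarrow> 'b measure \<Rightarrow> (('a \<Rightarrow> real) \<Rightarrow> ('b \<Rightarrow> real)) \<Rightarrow> bool" where
  "compact_operator M N A \<longleftrightarrow>
     (\<forall>x :: nat \<Rightarrow> 'a \<Rightarrow> real. (\<forall>n. x n \<in> L1 M \<and> norm_1 M (x n) \<le> 1) \<longrightarrow>
        (\<exists>z\<in>Linf N. \<exists>r. strict_mono r \<and>
           (\<lambda>n. norm_inf N (\<lambda>t. A (x (r n)) t - z t)) \<longlonglongrightarrow> 0))"

text \<open>Well-posedness in the sense of Hadamard: existence, uniqueness and stability.\<close>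

definition well_posed ::
    "'a measure \<Rightarrow> 'b measure \<Rightarrow> (('a \<Rightarrow> real) \<Rightarrow> ('b \<Rightarrow> real)) \<Rightarrow> bool" where
  "well_posed M N A \<longleftrightarrow>
     (\<forall>g\<in>Linf N. \<exists>u\<in>L1 M. AE t in N. A u t = g t) \<and>
     (\<forall>u\<in>L1 M. \<forall>v\<in>L1 M. (AE t in N. A u t = A v t) \<longrightarrow> (AE t in M. u t = v t)) \<and>
     (\<forall>u\<in>L1 M. \<forall>\<epsilon>>0. \<exists>\<delta>>0. \<forall>v\<in>L1 M.
        norm_inf N (\<lambda>t. A v t - A u t) < \<delta> \<longrightarrow> norm_1 M (\<lambda>t. v t - u t) < \<epsilon>)"

definition ill_posed ::
    "'a measure \<Rightarrow> 'b measure \<Rightarrow> (('a \<Rightarrow> real) \<Rightarrow> ('b \<Rightarrow> real)) \<Rightarrow> bool" where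
  "ill_posed M N A \<longleftrightarrow> \<not> well_posed M N A"


text \<open>Functionals with values in the extended reals without \<^term>\<open>- \<infinity> :: ereal\<close>.\<close>

definition proper_functional :: "'a measure \<Rightarrow> (('a \<Rightarrow> real) \<Rightarrow> ereal) \<Rightarrow> bool" where
  "proper_functional M R \<longleftrightarrow>
     (\<forall>u\<in>L1 M. \<forall>v\<in>L1 M. (AE t in M. u t = v t) \<longrightarrow> R u = R v) \<and>
     (\<forall>u\<in>L1 M. R u \<noteq> - \<infinity>) \<and> (\<exists>u\<in>L1 M. R u < \<infinity>)"

definition convex_functional :: "'a measure \<Rightarrow> (('a \<Rightarrow> real) \<Rightarrow> ereal) \<Rightarrow> bool" where
  "convex_functional M R \<longleftrightarrow>
     (\<forall>u\<in>L1 M. \<forall>v\<in>L1 M. \<forall>c::real. 0 < c \<and> c < 1 \<longrightarrow>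
        R (\<lambda>t. c * u t + (1 - c) * v t) \<le> ereal c * R u + ereal (1 - c) * R v)"

definition lsc_functional :: "'a measure \<Rightarrow> (('a \<Rightarrow> real) \<Rightarrow> ereal) \<Rightarrow> bool" where
  "lsc_functional M R \<longleftrightarrow>
     (\<forall>u\<in>L1 M. \<forall>c. c < R u \<longrightarrow>
        (\<exists>\<delta>>0. \<forall>v\<in>L1 M. norm_1 M (\<lambda>t. v t - u t) < \<delta> \<longrightarrow> c < R v))"

definition continuous_at_Linf ::
    "'a measure \<Rightarrow> (('a \<Rightarrow> real) \<Rightarrow> ereal) \<Rightarrow> ('a \<Rightarrow> real) \<Rightarrow> bool" where
  "continuous_at_Linf M H z\<^sub>0 \<longleftrightarrow>
     (\<forall>V. open V \<and> H z\<^sub>0 \<in> V \<longrightarrow>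
        (\<exists>\<delta>>0. \<forall>z\<in>Linf M. norm_inf M (\<lambda>t. z t - z\<^sub>0 t) < \<delta> \<longrightarrow> H z \<in> V))"


definition kl_integrand :: "('a \<Rightarrow> real) \<Rightarrow> 'a \<Rightarrow> real \<Rightarrow> ereal" where
  "kl_integrand f t \<tau> =
     (if \<tau> > 0 then ereal (f t * ln (f t / \<tau>) - f t + \<tau>) else \<infinity>)"

text \<open>The condition in the conditional says that the extended-real valued integrand is in $L^1$.\<close>

definition KL :: "'a measure \<Rightarrow> ('a \<Rightarrow> real) \<Rightarrow> ('a \<Rightarrow> real) \<Rightarrow> ereal" where
  "KL M f z =
     (if (AE t in M. kl_integrand f t (z t) \<noteq> \<infinity>) \<and>
         integrable M (\<lambda>t. real_of_ereal (kl_integrand f t (z t)))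
      then ereal (\<integral>t. real_of_ereal (kl_integrand f t (z t)) \<partial>M) else \<infinity>)"


definition dual_L1 :: "'a measure \<Rightarrow> (('a \<Rightarrow> real) \<Rightarrow> real) set" where
  "dual_L1 M = {\<xi>.
     (\<forall>u\<in>L1 M. \<forall>v\<in>L1 M. \<xi> (\<lambda>t. u t + v t) = \<xi> u + \<xi> v) \<and>
     (\<forall>u\<in>L1 M. \<forall>c. \<xi> (\<lambda>t. c * u t) = c * \<xi> u) \<and>
     (\<exists>C. \<forall>u\<in>L1 M. \<bar>\<xi> u\<bar> \<le> C * norm_1 M u)}"

text \<open>The canonical embedding of $L^\infty$ into its own dual, and the Banach space adjoint.\<close>

definition as_functional :: "'b measure \<Rightarrow> ('b \<Rightarrow> real) \<Rightarrow> (('b \<Rightarrow> real) \<Rightarrow> real)" where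
  "as_functional N p = (\<lambda>z. \<integral>t. p t * z t \<partial>N)"

definition adjoint_op ::
    "(('a \<Rightarrow> real) \<Rightarrow> ('b \<Rightarrow> real)) \<Rightarrow> (('b \<Rightarrow> real) \<Rightarrow> real) \<Rightarrow> (('a \<Rightarrow> real) \<Rightarrow> real)" where
  "adjoint_op A q = (\<lambda>u. q (A u))"

definition subdifferential ::
    "'a measure \<Rightarrow> (('a \<Rightarrow> real) \<Rightarrow> ereal) \<Rightarrow> ('a \<Rightarrow> real) \<Rightarrow> (('a \<Rightarrow> real) \<Rightarrow> real) set" where
  "subdifferential M R u = {\<xi> \<in> dual_L1 M. \<bar>R u\<bar> \<noteq> \<infinity> \<and>
     (\<forall>v\<in>L1 M. R u + ereal (\<xi> (\<lambda>t. v t - u t)) \<le> R v)}"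

definition fenchel_conjugate ::
    "'a measure \<Rightarrow> (('a \<Rightarrow> real) \<Rightarrow> ereal) \<Rightarrow> (('a \<Rightarrow> real) \<Rightarrow> real) \<Rightarrow> ereal" where
  "fenchel_conjugate M R \<xi> = (SUP u\<in>L1 M. ereal (\<xi> u) - R u)"

text \<open>Bregman distance of \<open>R\<close> between \<open>u\<close> and \<open>v\<close> with respect to \<open>\<xi>\<close> in the subdifferential of \<open>R\<close> at \<open>v\<close>.\<close>

definition bregman ::
    "(('a \<Rightarrow> real) \<Rightarrow> ereal) \<Rightarrow> (('a \<Rightarrow> real) \<Rightarrow> real) \<Rightarrow> ('a \<Rightarrow> real) \<Rightarrow> ('a \<Rightarrow> real) \<Rightarrow> ereal" where
  "bregman R \<xi> u v = R u - R v - ereal (\<xi> (\<lambda>t. u t - v t))"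

text \<open>Bregman distance of the functional \<open>S\<close> on the dual between \<open>\<xi>\<close> and \<open>\<eta>\<close>; the subgradient of \<open>S\<close>
  at \<open>\<eta>\<close> is given by the element \<open>u\<close> of the primal space.\<close>

definition bregman_dual ::
    "((('a \<Rightarrow> real) \<Rightarrow> real) \<Rightarrow> ereal) \<Rightarrow> ('a \<Rightarrow> real) \<Rightarrow>
     (('a \<Rightarrow> real) \<Rightarrow> real) \<Rightarrow> (('a \<Rightarrow> real) \<Rightarrow> real) \<Rightarrow> ereal" where
  "bregman_dual S u \<xi> \<eta> = S \<xi> - S \<eta> - ereal (\<xi> u - \<eta> u)"


definition ext_apply :: "(real \<Rightarrow> real) \<Rightarrow> ereal \<Rightarrow> ereal" where
  "ext_apply \<Phi> x = (if x = \<infinity> then \<infinity> else ereal (\<Phi> (real_of_ereal x)))"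

definition ext_inverse :: "(real \<Rightarrow> real) \<Rightarrow> real \<Rightarrow> ereal" where
  "ext_inverse \<Phi> s = (if s \<in> \<Phi> ` {0..} then ereal (the_inv_into {0..} \<Phi> s) else \<infinity>)"

definition convex_conjugate :: "(real \<Rightarrow> ereal) \<Rightarrow> real \<Rightarrow> ereal" where
  "convex_conjugate g \<alpha> = (SUP t\<in>{0..}. ereal (\<alpha> * t) - g t)"

end

theory Submission
  imports Defs
begin

text \<open>
  Write \<open>z = A u\<^sub>\<alpha>\<close> and \<open>p\<^sub>\<alpha> = (f / z - 1) / \<alpha>\<close>. As \<open>1 - f / z\<close> is the gradient of \<open>H\<^sub>f\<close> at \<open>z\<close>,
  minimality of \<open>u\<^sub>\<alpha>\<close> means that \<open>A\<^sup>* p\<^sub>\<alpha>\<close> is a subgradient of \<open>R\<close> at \<open>u\<^sub>\<alpha>\<close>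
  (\<open>KL_minimizer_subgradient\<close>). With \<open>A\<^sup>* p\<^sup>\<dagger>\<close> a subgradient at \<open>u\<^sup>\<dagger>\<close>, the two Bregman distances
  add up to a symmetric pairing (\<open>bregman_sum\<close>), and \<open>f = z (1 + \<alpha> p\<^sub>\<alpha>)\<close> turns it into
  \<open>D\<^sub>R + D\<^sub>R\<^sub>* = \<integral> (p\<^sub>\<alpha> - p\<^sup>\<dagger>) (z - f) = \<alpha> \<integral> z p\<^sub>\<alpha> (p\<^sup>\<dagger> - p\<^sub>\<alpha>)\<close>.

  The source condition bounds the similar integral \<open>\<integral> f p\<^sup>\<dagger> (p\<^sup>\<dagger> - p\<^sub>\<alpha>)\<close> by \<open>\<Phi>(D\<^sub>R\<^sub>*)\<close>. The two
  integrands are compared pointwise: for small \<open>\<alpha>\<close> the first exceeds the second by at most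
  \<open>\<alpha>\<^sup>2 f\<^sup>2 (p\<^sup>\<dagger>)\<^sup>4 / (4 \<gamma>)\<close>, which comes from completing a square in \<open>p\<^sup>\<dagger> - p\<^sub>\<alpha>\<close>
  (\<open>KL_dual_pairing_bound\<close>). Hence \<open>D\<^sub>R \<le> \<alpha> \<Phi>(D\<^sub>R\<^sub>*) - D\<^sub>R\<^sub>* + \<alpha> s\<close> with
  \<open>s = \<alpha>\<^sup>2 \<parallel>f (p\<^sup>\<dagger>)\<^sup>2\<parallel>\<^sub>2\<^sup>2 / (4 \<gamma>)\<close>. By Young's inequality for \<open>\<Phi>\<^sup>-\<^sup>1\<close> and its conjugate \<open>\<Psi>\<close>, the
  difference of the first two terms is at most \<open>\<Psi>(\<alpha>)\<close> and the last term at most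
  \<open>\<Psi>(\<alpha>) + \<Phi>\<^sup>-\<^sup>1(s)\<close> (\<open>conjugate_rate_bound\<close>).
\<close>

section \<open>Essentially bounded functions\<close>

lemma mem_Linf_iff:
  "z \<in> Linf N \<longleftrightarrow> z \<in> borel_measurable N \<and> (\<exists>C\<ge>0. AE t in N. \<bar>z t\<bar> \<le> C)"
proof (intro iffI conjI)
  assume z: "z \<in> Linf N"
  then show "z \<in> borel_measurable N"
    by (simp add: Linf_def)
  obtain C :: real where C: "esssup N (\<lambda>t. ereal \<bar>z t\<bar>) < ereal C"
    using z ereal_dense2 unfolding Linf_def by blast
  have "AE t in N. ereal \<bar>z t\<bar> \<le> esssup N (\<lambda>t. ereal \<bar>z t\<bar>)"
    by (rule esssup_AE)
  then have "AE t in N. \<bar>z t\<bar> \<le> max C 0"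
    by (rule AE_mp) (use C in \<open>auto simp: le_max_iff_disj dest: le_less_trans less_imp_le intro!: AE_I2\<close>)
  then show "\<exists>C\<ge>0. AE t in N. \<bar>z t\<bar> \<le> C"
    by (intro exI[of _ "max C 0"]) auto
next
  assume "z \<in> borel_measurable N \<and> (\<exists>C\<ge>0. AE t in N. \<bar>z t\<bar> \<le> C)"
  then obtain C where z: "z \<in> borel_measurable N" and "AE t in N. \<bar>z t\<bar> \<le> C"
    by auto
  then have "esssup N (\<lambda>t. ereal \<bar>z t\<bar>) \<le> ereal C"
    by (intro esssup_I) auto
  then have "esssup N (\<lambda>t. ereal \<bar>z t\<bar>) < \<infinity>"
    by (rule order_le_less_trans) simp
  then show "z \<in> Linf N"
    using z by (simp add: Linf_def)
qed

lemma Linf_const: "(\<lambda>_. c) \<in> Linf N"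
  by (auto simp: mem_Linf_iff intro: exI[of _ "\<bar>c\<bar>"])

lemma Linf_add:
  assumes "z \<in> Linf N" "w \<in> Linf N" shows "(\<lambda>t. z t + w t) \<in> Linf N"
proof -
  obtain C D where "0 \<le> C" "0 \<le> D" and C: "AE t in N. \<bar>z t\<bar> \<le> C" and D: "AE t in N. \<bar>w t\<bar> \<le> D"
    using assms by (auto simp: mem_Linf_iff)
  have "AE t in N. \<bar>z t + w t\<bar> \<le> C + D"
    using C D by eventually_elim auto
  with \<open>0 \<le> C\<close> \<open>0 \<le> D\<close> show ?thesis
    using assms by (auto simp: mem_Linf_iff intro!: exI[of _ "C + D"])
qed

lemma Linf_mult:
  assumes "z \<in> Linf N" "w \<in> Linf N" shows "(\<lambda>t. z t * w t) \<in> Linf N"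
proof -
  obtain C D where "0 \<le> C" "0 \<le> D" and C: "AE t in N. \<bar>z t\<bar> \<le> C" and D: "AE t in N. \<bar>w t\<bar> \<le> D"
    using assms by (auto simp: mem_Linf_iff)
  have "AE t in N. \<bar>z t * w t\<bar> \<le> C * D"
    using C D by eventually_elim (auto simp: abs_mult intro!: mult_mono)
  with \<open>0 \<le> C\<close> \<open>0 \<le> D\<close> show ?thesis
    using assms by (auto simp: mem_Linf_iff intro!: exI[of _ "C * D"])
qed

lemma Linf_diff:
  assumes "z \<in> Linf N" "w \<in> Linf N" shows "(\<lambda>t. z t - w t) \<in> Linf N"
  using Linf_add[OF assms(1) Linf_mult[OF Linf_const[of "-1"] assms(2)]] by simp

lemma Linf_power:
  assumes "z \<in> Linf N" shows "(\<lambda>t. z t ^ n) \<in> Linf N"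
  by (induction n) (auto intro: Linf_const Linf_mult assms)

lemma Linf_divide:
  assumes "z \<in> Linf N" "w \<in> Linf N" "e > 0" "AE t in N. e \<le> w t"
  shows "(\<lambda>t. z t / w t) \<in> Linf N"
proof -
  have "AE t in N. \<bar>inverse (w t)\<bar> \<le> inverse e"
    using assms(4) by eventually_elim (use \<open>e > 0\<close> in \<open>auto intro!: le_imp_inverse_le\<close>)
  then have "(\<lambda>t. inverse (w t)) \<in> Linf N"
    using assms(2,3) by (auto simp: mem_Linf_iff intro!: exI[of _ "inverse e"])
  from Linf_mult[OF assms(1) this] show ?thesis
    by (simp add: divide_inverse)
qed

lemmas Linf_intros = Linf_const Linf_add Linf_mult Linf_diff Linf_power

lemma (in finite_measure) integrable_Linf: "z \<in> Linf M \<Longrightarrow> integrable M z"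
  by (auto simp: mem_Linf_iff intro!: integrable_const_bound)

lemma AE_ge_of_le_ess_inf:
  assumes "ereal c \<le> ess_inf N v"
  shows "AE t in N. c \<le> v t"
proof -
  have "AE t in N. - ereal (v t) \<le> esssup N (\<lambda>t. - ereal (v t))"
    by (rule esssup_AE)
  then show ?thesis
  proof eventually_elim
    case (elim t)
    have "esssup N (\<lambda>t. - ereal (v t)) \<le> - ereal c"
      using assms unfolding ess_inf_def by (metis ereal_minus_le_minus ereal_uminus_uminus)
    from order_trans[OF elim this] show ?case
      by simp
  qed
qed


section \<open>Second-order expansion of the Kullback-Leibler functional\<close>

text \<open>
  When \<open>f\<close> and \<open>w\<close> both take values in a compact subset of \<open>(0, \<infinity>)\<close>, the integrand is bounded,
  so on a finite measure space the functional takes the finite branch of its definition.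
\<close>

lemma KL_bounded_away:
  assumes N: "finite_measure N" and f: "f \<in> borel_measurable N" and w: "w \<in> borel_measurable N"
    and "c > 0" "e > 0"
    and fb: "AE t in N. c \<le> f t \<and> f t \<le> c'" and wb: "AE t in N. e \<le> w t \<and> w t \<le> C"
  shows "integrable N (\<lambda>t. f t * ln (f t / w t) - f t + w t)"
    and "KL N f w = ereal (\<integral>t. f t * ln (f t / w t) - f t + w t \<partial>N)"
proof -
  have ln_abs: "\<bar>ln x\<bar> \<le> x + 1 / x" if "x > 0" for x :: real
  proof -
    have "ln x \<le> x" "ln (1 / x) \<le> 1 / x"
      using that by (auto intro: less_imp_le ln_less_self)
    moreover have "ln (1 / x) = - ln x" "0 < 1 / x"
      using that by (auto simp: ln_div)
    ultimately show ?thesis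
      using that by linarith
  qed
  have "AE t in N. \<bar>f t * ln (f t / w t) - f t + w t\<bar> \<le> c' * (c' / e + C / c) + c' + C"
    using fb wb
  proof eventually_elim
    case (elim t)
    then have pos: "0 < f t" "0 < w t" "0 < c'" "0 < C"
      using \<open>c > 0\<close> \<open>e > 0\<close> by linarith+
    have "\<bar>ln (f t / w t)\<bar> \<le> f t / w t + w t / f t"
      using ln_abs[of "f t / w t"] pos by simp
    also have "\<dots> \<le> c' / e + C / c"
      using elim pos \<open>c > 0\<close> \<open>e > 0\<close> by (intro add_mono frac_le) auto
    finally have "\<bar>f t * ln (f t / w t)\<bar> \<le> c' * (c' / e + C / c)"
      using elim pos by (auto simp: abs_mult intro!: mult_mono)
    then show ?case
      using elim pos by linarith
  qed
  then show int: "integrable N (\<lambda>t. f t * ln (f t / w t) - f t + w t)"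
    using f w by (intro finite_measure.integrable_const_bound[OF N]) auto
  have eq: "AE t in N. real_of_ereal (kl_integrand f t (w t)) = f t * ln (f t / w t) - f t + w t"
    using wb by eventually_elim (use \<open>e > 0\<close> in \<open>auto simp: kl_integrand_def\<close>)
  have fin: "AE t in N. kl_integrand f t (w t) \<noteq> \<infinity>"
    using wb by eventually_elim (use \<open>e > 0\<close> in \<open>auto simp: kl_integrand_def\<close>)
  have m: "(\<lambda>t. real_of_ereal (kl_integrand f t (w t))) \<in> borel_measurable N"
  proof -
    have "(\<lambda>t. real_of_ereal (kl_integrand f t (w t))) =
        (\<lambda>t. if w t > 0 then f t * ln (f t / w t) - f t + w t else 0)"
      by (auto simp: kl_integrand_def)
    also have "\<dots> \<in> borel_measurable N"
      using f w by measurable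
    finally show ?thesis .
  qed
  have m': "(\<lambda>t. f t * ln (f t / w t) - f t + w t) \<in> borel_measurable N"
    using f w by measurable
  have "integrable N (\<lambda>t. real_of_ereal (kl_integrand f t (w t)))"
    using int integrable_cong_AE[OF m m' eq] by simp
  then show "KL N f w = ereal (\<integral>t. f t * ln (f t / w t) - f t + w t \<partial>N)"
    using fin integral_cong_AE[OF m m' eq] by (simp add: KL_def)
qed

text \<open>
  One direction of differentiability at \<open>z\<close> along \<open>h\<close>, with a quadratic remainder that is uniform
  in \<open>t\<close> since \<open>h / z\<close> is essentially bounded. The perturbed argument is a function \<open>w\<close> that
  agrees with \<open>z + s h\<close> almost everywhere, because a linear operator on classes of functions
  is additive on representatives only up to null sets.
\<close>

lemma KL_upper_expansion:
  assumes N: "finite_measure N" and fL: "f \<in> Linf N" and z: "z \<in> Linf N"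
    and h: "h \<in> Linf N" and "c > 0" "e > 0"
    and fb: "AE t in N. c \<le> f t \<and> f t \<le> c'" and ze: "AE t in N. e \<le> z t"
  shows "\<exists>K. \<exists>s\<^sub>0>0. \<forall>s w. 0 < s \<and> s < s\<^sub>0 \<and> w \<in> borel_measurable N \<and> (AE t in N. w t = z t + s * h t)
    \<longrightarrow> KL N f w \<le> KL N f z + ereal (s * (\<integral>t. (1 - f t / z t) * h t \<partial>N) + s\<^sup>2 * K)"
proof -
  interpret finite_measure N by (rule N)
  obtain C B where "0 \<le> C" "0 \<le> B" and C: "AE t in N. \<bar>z t\<bar> \<le> C" and B: "AE t in N. \<bar>h t\<bar> \<le> B"
    using z h by (auto simp: mem_Linf_iff)
  have f: "f \<in> borel_measurable N" and zm: "z \<in> borel_measurable N"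
    using fL z by (auto simp: mem_Linf_iff)
  define k where "k = (\<lambda>w t. f t * ln (f t / w t) - f t + w t)"
  define q where "q = 2 * c' * (B / e)\<^sup>2"
  \<comment> \<open>For \<open>s < s\<^sub>0\<close> the ratio \<open>s h / z\<close> is at most \<open>1 / 2\<close>: then \<open>z + s h\<close> is bounded away from \<open>0\<close>
    and \<open>ln (1 + x) \<ge> x - 2 x\<^sup>2\<close> applies. The summand \<open>1\<close> covers \<open>B = 0\<close>.\<close>
  define s\<^sub>0 where "s\<^sub>0 = e / (2 * (B + 1))"
  have "s\<^sub>0 > 0"
    using \<open>e > 0\<close> \<open>0 \<le> B\<close> by (simp add: s\<^sub>0_def)
  have zb: "AE t in N. e \<le> z t \<and> z t \<le> C"
    using ze C by eventually_elim auto
  note KLz = KL_bounded_away[OF N f zm \<open>c > 0\<close> \<open>e > 0\<close> fb zb]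
  have lin: "integrable N (\<lambda>t. (1 - f t / z t) * h t)"
    by (intro integrable_Linf Linf_intros Linf_divide[OF _ _ \<open>e > 0\<close> ze] fL z h)
  have "KL N f w \<le> KL N f z + ereal (s * (\<integral>t. (1 - f t / z t) * h t \<partial>N) + s\<^sup>2 * (q * measure N (space N)))"
    if s: "0 < s" "s < s\<^sub>0" and w: "w \<in> borel_measurable N" and weq: "AE t in N. w t = z t + s * h t" for s w
  proof -
    have small: "AE t in N. \<bar>s * h t\<bar> \<le> e / 2"
      using B
    proof eventually_elim
      case (elim t)
      have "\<bar>s * h t\<bar> = s * \<bar>h t\<bar>"
        using s by (simp add: abs_mult)
      also have "\<dots> \<le> s\<^sub>0 * (B + 1)"
        using s elim \<open>0 \<le> B\<close> by (intro mult_mono) auto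
      also have "\<dots> = e / 2"
        using \<open>0 \<le> B\<close> by (simp add: s\<^sub>0_def field_simps)
      finally show ?case .
    qed
    have wb: "AE t in N. e / 2 \<le> w t \<and> w t \<le> C + e / 2"
      using weq small zb by eventually_elim (auto simp: abs_le_iff)
    have "e / 2 > 0"
      using \<open>e > 0\<close> by simp
    note KLw = KL_bounded_away[OF N f w \<open>c > 0\<close> this fb wb]
    have "AE t in N. k w t \<le> k z t + s * ((1 - f t / z t) * h t) + s\<^sup>2 * q"
      using weq small zb fb B
    proof eventually_elim
      case (elim t)
      define x where "x = s * h t / z t"
      have pos: "0 < z t" "0 < f t" "0 < c'"
        using elim \<open>c > 0\<close> \<open>e > 0\<close> by linarith+
      have "\<bar>x\<bar> = \<bar>s * h t\<bar> / z t"
        using pos by (simp add: x_def)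
      also have "\<dots> \<le> (e / 2) / e"
        using elim pos \<open>e > 0\<close> by (intro frac_le) auto
      finally have x_half: "\<bar>x\<bar> \<le> 1 / 2"
        using \<open>e > 0\<close> by simp
      have "\<bar>x\<bar> = s * (\<bar>h t\<bar> / z t)"
        using pos s by (simp add: x_def abs_mult)
      also have "\<dots> \<le> s * (B / e)"
        using elim pos s \<open>e > 0\<close> by (intro mult_left_mono frac_le) auto
      finally have "\<bar>x\<bar>\<^sup>2 \<le> (s * (B / e))\<^sup>2"
        by (intro power_mono) auto
      then have x_sq: "x\<^sup>2 \<le> s\<^sup>2 * (B / e)\<^sup>2"
        by (simp only: power_mult_distrib power2_abs)
      have "- ln (1 + x) \<le> - x + 2 * x\<^sup>2"
        using abs_ln_one_plus_x_minus_x_bound[OF x_half] by linarith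
      then have "f t * (- ln (1 + x)) \<le> f t * (- x + 2 * x\<^sup>2)"
        using pos by (intro mult_left_mono) auto
      also have "f t * (2 * x\<^sup>2) \<le> c' * (2 * (s\<^sup>2 * (B / e)\<^sup>2))"
        using elim pos x_sq by (intro mult_mono) auto
      then have "f t * (- x + 2 * x\<^sup>2) \<le> - f t * x + s\<^sup>2 * q"
        by (simp add: q_def algebra_simps)
      finally have ln_bd: "- f t * ln (1 + x) \<le> - f t * x + s\<^sup>2 * q"
        by simp
      have "w t = z t * (1 + x)"
        using elim pos by (simp add: x_def algebra_simps)
      moreover have "1 + x > 0"
        using x_half by linarith
      ultimately have ln_split: "ln (f t / w t) = ln (f t / z t) - ln (1 + x)"
        using pos by (simp add: ln_div ln_mult)
      have "k w t = k z t - f t * ln (1 + x) + s * h t"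
        unfolding k_def ln_split using elim(1) by (simp add: algebra_simps)
      also have "\<dots> \<le> k z t - f t * x + s\<^sup>2 * q + s * h t"
        using ln_bd by linarith
      also have "\<dots> = k z t + s * ((1 - f t / z t) * h t) + s\<^sup>2 * q"
        using pos by (simp add: x_def field_simps)
      finally show ?case .
    qed
    then have "(\<integral>t. k w t \<partial>N) \<le> (\<integral>t. k z t + s * ((1 - f t / z t) * h t) + s\<^sup>2 * q \<partial>N)"
      using KLw(1) KLz(1) lin by (intro integral_mono_AE) (auto simp: k_def)
    also have "\<dots> = (\<integral>t. k z t \<partial>N) + s * (\<integral>t. (1 - f t / z t) * h t \<partial>N) + s\<^sup>2 * (q * measure N (space N))"
    proof -
      have "integrable N (\<lambda>t. k z t)"
        using KLz(1) by (simp add: k_def)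
      then show ?thesis
        using lin by simp
    qed
    finally show ?thesis
      using KLw(2) KLz(2) by (simp add: k_def)
  qed
  with \<open>s\<^sub>0 > 0\<close> show ?thesis
    by blast
qed


section \<open>Duality between the Bregman distances\<close>

lemma nonneg_of_linear_perturbation:
  fixes x K s\<^sub>0 :: real
  assumes "s\<^sub>0 > 0" and le: "\<And>s. 0 < s \<Longrightarrow> s < s\<^sub>0 \<Longrightarrow> 0 \<le> x + s * K"
  shows "0 \<le> x"
proof (rule tendsto_lowerbound)
  show "((\<lambda>s. x + s * K) \<longlongrightarrow> x) (at_right 0)"
    by (auto intro!: tendsto_eq_intros)
  show "\<forall>\<^sub>F s in at_right 0. 0 \<le> x + s * K"
    using eventually_at_right_less[of 0] eventually_at_right_real[OF \<open>s\<^sub>0 > 0\<close>]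
    by eventually_elim (use le in auto)
qed auto

lemma linear_operator_Linf: "linear_operator M N A \<Longrightarrow> u \<in> L1 M \<Longrightarrow> A u \<in> Linf N"
  by (simp add: linear_operator_def)

lemma linear_operator_affine:
  assumes "linear_operator M N A" "u \<in> L1 M" "v \<in> L1 M"
  shows "(\<lambda>t. a * u t + b * v t) \<in> L1 M"
    and "AE t in N. A (\<lambda>t. a * u t + b * v t) t = a * A u t + b * A v t"
proof -
  have L1: "(\<lambda>t. a * u t) \<in> L1 M" "(\<lambda>t. b * v t) \<in> L1 M"
    using assms(2,3) by (auto simp: L1_def)
  then show "(\<lambda>t. a * u t + b * v t) \<in> L1 M"
    by (auto simp: L1_def)
  have "\<forall>u\<in>L1 M. \<forall>v\<in>L1 M. AE t in N. A (\<lambda>s. u s + v s) t = A u t + A v t"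
    using assms(1) unfolding linear_operator_def by (elim conjE)
  from bspec[OF bspec[OF this L1(1)] L1(2)]
  have "AE t in N. A (\<lambda>t. a * u t + b * v t) t = A (\<lambda>t. a * u t) t + A (\<lambda>t. b * v t) t"
    by simp
  moreover have "AE t in N. A (\<lambda>t. a * u t) t = a * A u t" "AE t in N. A (\<lambda>t. b * v t) t = b * A v t"
    using assms unfolding linear_operator_def by blast+
  ultimately show "AE t in N. A (\<lambda>t. a * u t + b * v t) t = a * A u t + b * A v t"
    by eventually_elim simp
qed

text \<open>
  The first-order optimality condition of the Tikhonov problem. It avoids a sum rule for
  subdifferentials: the minimizer is compared with the points \<open>s v + (1 - s) u\<close> of the segment
  towards \<open>v\<close>. Along it the penalty is controlled by convexity and the fidelity by
  \<open>KL_upper_expansion\<close>, whose remainder disappears after division by \<open>s\<close> as \<open>s \<rightarrow> 0\<close>.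
\<close>

lemma KL_minimizer_subgradient:
  assumes N: "finite_measure N" and A: "linear_operator M N A" and f: "f \<in> Linf N"
    and "c > 0" and fb: "AE t in N. c \<le> f t \<and> f t \<le> c'"
    and R: "convex_functional M R" "\<forall>v\<in>L1 M. R v \<noteq> - \<infinity>"
    and "\<alpha> > 0"
    and min: "is_arg_min (\<lambda>v. ereal (1 / \<alpha>) * KL N f (A v) + R v) (\<lambda>v. v \<in> L1 M) u"
    and Ru: "R u = ereal r"
    and "e > 0" and ze: "AE t in N. e \<le> A u t"
    and v: "v \<in> L1 M"
  shows "R u + ereal (\<integral>t. (f t / A u t - 1) / \<alpha> * (A v t - A u t) \<partial>N) \<le> R v"
proof (cases "R v")
  case MInf
  then show ?thesis
    using R(2) v by blast
next
  case (real rv)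
  have u: "u \<in> L1 M"
    using min by (simp add: is_arg_min_def)
  have Linf: "A u \<in> Linf N" "A v \<in> Linf N"
    by (rule linear_operator_Linf[OF A u] linear_operator_Linf[OF A v])+
  define h where "h = (\<lambda>t. A v t - A u t)"
  have hL: "h \<in> Linf N"
    unfolding h_def by (intro Linf_intros Linf)
  obtain C where C: "AE t in N. \<bar>A u t\<bar> \<le> C"
    using Linf(1) by (auto simp: mem_Linf_iff)
  have zb: "AE t in N. e \<le> A u t \<and> A u t \<le> C"
    using ze C by eventually_elim auto
  obtain k where k: "KL N f (A u) = ereal k"
    using KL_bounded_away(2)[OF N _ _ \<open>c > 0\<close> \<open>e > 0\<close> fb zb] f Linf(1) by (auto simp: mem_Linf_iff)
  define g where "g = (\<integral>t. (1 - f t / A u t) * h t \<partial>N)"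
  obtain K s\<^sub>0 where "s\<^sub>0 > 0" and up: "\<forall>s w. 0 < s \<and> s < s\<^sub>0 \<and> w \<in> borel_measurable N \<and>
      (AE t in N. w t = A u t + s * h t) \<longrightarrow> KL N f w \<le> KL N f (A u) + ereal (s * g + s\<^sup>2 * K)"
    using KL_upper_expansion[OF N f Linf(1) hL \<open>c > 0\<close> \<open>e > 0\<close> fb ze] unfolding g_def by blast
  have pert: "0 \<le> (g / \<alpha> + rv - r) + s * (K / \<alpha>)" if s: "0 < s" "s < min s\<^sub>0 1" for s
  proof -
    define w where "w = (\<lambda>t. s * v t + (1 - s) * u t)"
    have wL1: "w \<in> L1 M"
      unfolding w_def by (rule linear_operator_affine[OF A v u])
    have Aw: "AE t in N. A w t = A u t + s * h t"
      using linear_operator_affine(2)[OF A v u, of s "1 - s"] unfolding w_def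
      by eventually_elim (simp add: h_def algebra_simps)
    have "A w \<in> Linf N"
      by (rule linear_operator_Linf[OF A wL1])
    then have "KL N f (A w) \<le> KL N f (A u) + ereal (s * g + s\<^sup>2 * K)"
      using s Aw by (intro up[rule_format]) (simp add: mem_Linf_iff)
    then have KLw: "KL N f (A w) \<le> ereal (k + s * g + s\<^sup>2 * K)"
      by (simp add: k add.assoc)
    have "R w \<le> ereal s * R v + ereal (1 - s) * R u"
      using R(1) v u s unfolding convex_functional_def w_def by simp
    then have Rw: "R w \<le> ereal (s * rv + (1 - s) * r)"
      by (simp add: Ru real)
    have "ereal (1 / \<alpha>) * KL N f (A u) + R u \<le> ereal (1 / \<alpha>) * KL N f (A w) + R w"
      using min wL1 unfolding is_arg_min_def by (meson not_le)
    also have "\<dots> \<le> ereal (1 / \<alpha>) * ereal (k + s * g + s\<^sup>2 * K) + ereal (s * rv + (1 - s) * r)"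
      using KLw Rw \<open>\<alpha> > 0\<close> by (intro add_mono ereal_mult_left_mono) auto
    finally have "k / \<alpha> + r \<le> (k + s * g + s\<^sup>2 * K) / \<alpha> + (s * rv + (1 - s) * r)"
      by (simp add: k Ru)
    then have "0 \<le> s * ((g / \<alpha> + rv - r) + s * (K / \<alpha>))"
      by (simp add: add_divide_distrib power2_eq_square algebra_simps)
    then show ?thesis
      using s by (simp add: zero_le_mult_iff)
  qed
  have "0 \<le> g / \<alpha> + rv - r"
    by (rule nonneg_of_linear_perturbation[of "min s\<^sub>0 1", OF _ pert]) (use \<open>s\<^sub>0 > 0\<close> in auto)
  moreover have "(\<integral>t. (f t / A u t - 1) / \<alpha> * (A v t - A u t) \<partial>N) = - g / \<alpha>"
  proof -
    have "(\<integral>t. (f t / A u t - 1) / \<alpha> * (A v t - A u t) \<partial>N) =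
        (\<integral>t. (- 1 / \<alpha>) * ((1 - f t / A u t) * h t) \<partial>N)"
      by (simp add: h_def divide_inverse algebra_simps)
    then show ?thesis
      by (simp add: g_def)
  qed
  ultimately show ?thesis
    by (simp add: Ru real)
qed simp

text \<open>The case of equality in the Fenchel-Young inequality.\<close>

lemma fenchel_conjugate_eq_of_subgradient:
  assumes "u \<in> L1 M" "R u = ereal r" "\<And>v. v \<in> L1 M \<Longrightarrow> R u + ereal (\<xi> v - \<xi> u) \<le> R v"
  shows "fenchel_conjugate M R \<xi> = ereal (\<xi> u - r)"
  unfolding fenchel_conjugate_def
proof (rule antisym)
  show "(SUP v\<in>L1 M. ereal (\<xi> v) - R v) \<le> ereal (\<xi> u - r)"
  proof (rule SUP_least)
    fix v assume "v \<in> L1 M"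
    with assms(2,3) have "ereal (r + (\<xi> v - \<xi> u)) \<le> R v"
      by fastforce
    then show "ereal (\<xi> v) - R v \<le> ereal (\<xi> u - r)"
      by (cases "R v") auto
  qed
  show "ereal (\<xi> u - r) \<le> (SUP v\<in>L1 M. ereal (\<xi> v) - R v)"
    using assms(1,2) by (intro SUP_upper2[of u]) auto
qed

lemma as_functional_diff:
  assumes N: "finite_measure N" and A: "linear_operator M N A" and p: "p \<in> Linf N"
    and v: "v \<in> L1 M" and u: "u \<in> L1 M"
  shows "as_functional N p (A (\<lambda>t. v t - u t)) = as_functional N p (A v) - as_functional N p (A u)"
    and "as_functional N p (A v) - as_functional N p (A u) = (\<integral>t. p t * (A v t - A u t) \<partial>N)"
proof -
  have L1: "(\<lambda>t. v t - u t) \<in> L1 M"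
    using v u by (auto simp: L1_def)
  have L: "A u \<in> Linf N" "A v \<in> Linf N" "A (\<lambda>t. v t - u t) \<in> Linf N"
    by (rule linear_operator_Linf[OF A u] linear_operator_Linf[OF A v] linear_operator_Linf[OF A L1])+
  have AE: "AE t in N. A (\<lambda>t. v t - u t) t = A v t - A u t"
    using linear_operator_affine(2)[OF A v u, of 1 "-1"] by simp
  have int: "integrable N (\<lambda>t. p t * A u t)" "integrable N (\<lambda>t. p t * A v t)"
    by (intro finite_measure.integrable_Linf[OF N] Linf_intros L p)+
  then show *: "as_functional N p (A v) - as_functional N p (A u) = (\<integral>t. p t * (A v t - A u t) \<partial>N)"
    by (simp add: as_functional_def right_diff_distrib)
  have "(\<integral>t. p t * A (\<lambda>t. v t - u t) t \<partial>N) = (\<integral>t. p t * (A v t - A u t) \<partial>N)"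
    using L p AE by (intro integral_cong_AE) (auto simp: mem_Linf_iff)
  then show "as_functional N p (A (\<lambda>t. v t - u t)) = as_functional N p (A v) - as_functional N p (A u)"
    using * by (simp add: as_functional_def)
qed

text \<open>
  When both functionals are subgradients, equality in Fenchel-Young eliminates \<open>R\<close> and its
  conjugate from \<open>D\<^sub>R(u, w) + D\<^sub>R\<^sub>*(\<xi>, \<eta>)\<close>, and what remains is \<open>\<langle>\<xi> - \<eta>, u - w\<rangle>\<close>. Conjugates could be
  infinite; the dual distance is returned as a real number \<open>d\<close> so that the later estimates are real.
\<close>

lemma bregman_sum:
  assumes u: "u \<in> L1 M" "R u = ereal r" "\<And>v. v \<in> L1 M \<Longrightarrow> R u + ereal (\<xi> v - \<xi> u) \<le> R v"
    and w: "w \<in> L1 M" "R w = ereal r'" "\<And>v. v \<in> L1 M \<Longrightarrow> R w + ereal (\<eta> v - \<eta> w) \<le> R v"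
    and \<eta>: "\<eta> (\<lambda>t. u t - w t) = \<eta> u - \<eta> w"
  obtains d where "d \<ge> 0" "bregman_dual (fenchel_conjugate M R) w \<xi> \<eta> = ereal d"
    "bregman R \<eta> u w = ereal ((\<xi> u - \<xi> w) - (\<eta> u - \<eta> w) - d)"
proof
  note conj = fenchel_conjugate_eq_of_subgradient[where \<xi> = \<xi>, OF u]
    fenchel_conjugate_eq_of_subgradient[where \<xi> = \<eta>, OF w]
  show "0 \<le> r' - r - (\<xi> w - \<xi> u)"
    using u(3)[OF w(1)] by (simp add: u(2) w(2))
  show "bregman_dual (fenchel_conjugate M R) w \<xi> \<eta> = ereal (r' - r - (\<xi> w - \<xi> u))"
    by (simp add: bregman_dual_def conj)
  show "bregman R \<eta> u w = ereal ((\<xi> u - \<xi> w) - (\<eta> u - \<eta> w) - (r' - r - (\<xi> w - \<xi> u)))"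
    by (simp add: bregman_def u(2) w(2) \<eta>)
qed


section \<open>The two scalar inequalities\<close>

text \<open>
  The pointwise comparison of the pairing in \<open>D\<^sub>R + D\<^sub>R\<^sub>*\<close> with the one in the variational source
  condition; \<open>a\<close>, \<open>b\<close>, \<open>z\<close> are values of \<open>p\<^sup>\<dagger>\<close>, \<open>p\<^sub>\<alpha>\<close> and \<open>A u\<^sub>\<alpha>\<close>. With \<open>d = a - b\<close> and \<open>x = \<alpha> a\<^sup>2\<close>
  the gap \<open>f a d - z b d\<close> equals \<open>z ((1 - \<alpha> a) d\<^sup>2 + x d)\<close>, a quadratic in \<open>d\<close> that is negative
  only for some \<open>d < 0\<close>. For such \<open>d\<close> the relation \<open>f = z (1 + \<alpha> b)\<close> keeps \<open>f\<close> above
  \<open>9 z / 10\<close>, so that \<open>f\<^sup>2 \<ge> (81 / 100) m z\<close>, and completing the square is possible with some room to spare: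
  \<open>\<gamma> = 2 m / 3\<close> instead of \<open>m\<close> provides that room.
\<close>

lemma KL_dual_pairing_bound:
  fixes f z a b \<alpha> m :: real
  assumes "m > 0" "m \<le> z" "\<alpha> > 0" and f: "f = z * (1 + \<alpha> * b)" and small: "\<alpha> * \<bar>a\<bar> \<le> 1 / 10"
  shows "z * b * (a - b) \<le> f * a * (a - b) + \<alpha>\<^sup>2 * ((f * a\<^sup>2)\<^sup>2 / (4 * (2 * m / 3)))"
proof -
  define d where "d = a - b"
  define x where "x = \<alpha> * a\<^sup>2"
  have "z > 0"
    using assms by linarith
  have \<alpha>a: "- (1 / 10) \<le> \<alpha> * a" "\<alpha> * a \<le> 1 / 10"
    using abs_le_D1[of "\<alpha> * a" "1 / 10"] abs_le_D2[of "\<alpha> * a" "1 / 10"] small \<open>\<alpha> > 0\<close>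
    by (auto simp: abs_mult)
  have "x \<ge> 0"
    using \<open>\<alpha> > 0\<close> by (simp add: x_def)
  have "0 \<le> z * ((1 - \<alpha> * a) * d\<^sup>2 + x * d) + (f * x)\<^sup>2 / (4 * (2 * m / 3))"
  proof (cases "d \<ge> 0")
    case True
    then show ?thesis
      using \<open>z > 0\<close> \<open>m > 0\<close> \<open>x \<ge> 0\<close> \<alpha>a by (intro add_nonneg_nonneg mult_nonneg_nonneg) auto
  next
    case False
    \<comment> \<open>Since \<open>b = a - d > a\<close>, the factor \<open>1 + \<alpha> b\<close> exceeds \<open>1 + \<alpha> a \<ge> 9 / 10\<close>.\<close>
    have "f = z * (1 + \<alpha> * a - \<alpha> * d)"
      by (simp add: f d_def algebra_simps)
    moreover have "\<alpha> * d \<le> 0"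
      using False \<open>\<alpha> > 0\<close> by (simp add: mult_le_0_iff)
    ultimately have "z * (9 / 10) \<le> f"
      using \<alpha>a \<open>z > 0\<close> by simp
    then have "(z * (9 / 10))\<^sup>2 \<le> f\<^sup>2"
      using \<open>z > 0\<close> by (intro power_mono) auto
    then have "(81 / 100) * (z * z) \<le> f\<^sup>2"
      by (simp add: power2_eq_square)
    moreover have "0 < m * z"
      using \<open>m > 0\<close> \<open>z > 0\<close> by simp
    moreover have "m * z \<le> z * z"
      using \<open>m \<le> z\<close> \<open>z > 0\<close> by (intro mult_right_mono) auto
    ultimately have "(8 / 10) * (m * z) \<le> f\<^sup>2"
      by linarith
    then have "(8 / 10) * (m * z) * x\<^sup>2 \<le> f\<^sup>2 * x\<^sup>2"
      by (intro mult_right_mono) auto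
    then have "(3 / 10) * z * x\<^sup>2 \<le> (f * x)\<^sup>2 / (4 * (2 * m / 3))"
      using \<open>m > 0\<close> by (simp add: field_simps power_mult_distrib)
    moreover have "0 \<le> z * ((1 - \<alpha> * a) * d\<^sup>2 + x * d + (3 / 10) * x\<^sup>2)"
    proof -
      have "(9 / 10) * d\<^sup>2 \<le> (1 - \<alpha> * a) * d\<^sup>2"
        using \<alpha>a by (intro mult_right_mono) auto
      moreover have "(9 / 10) * d\<^sup>2 + x * d + (3 / 10) * x\<^sup>2
          = (9 / 10) * (d + (5 / 9) * x)\<^sup>2 + (1 / 45) * x\<^sup>2"
        by (simp add: power2_eq_square algebra_simps)
      moreover have "0 \<le> (9 / 10) * (d + (5 / 9) * x)\<^sup>2 + (1 / 45) * x\<^sup>2"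
        by simp
      ultimately show ?thesis
        using \<open>z > 0\<close> by (intro mult_nonneg_nonneg) linarith+
    qed
    ultimately show ?thesis
      by (simp add: algebra_simps)
  qed
  moreover have "f * a * (a - b) - z * b * (a - b) = z * ((1 - \<alpha> * a) * d\<^sup>2 + x * d)"
    by (simp add: f d_def x_def power2_eq_square algebra_simps)
  moreover have "(f * x)\<^sup>2 / (4 * (2 * m / 3)) = \<alpha>\<^sup>2 * ((f * a\<^sup>2)\<^sup>2 / (4 * (2 * m / 3)))"
    by (simp add: x_def power_mult_distrib)
  ultimately show ?thesis
    by linarith
qed

lemma ext_inverse_apply:
  assumes "strict_mono_on {0..} \<Phi>" "d \<ge> 0"
  shows "ext_inverse \<Phi> (\<Phi> d) = ereal d"
  using the_inv_into_f_f[OF strict_mono_on_imp_inj_on[OF assms(1)], of d] assms(2)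
  by (simp add: ext_inverse_def)

lemma ext_inverse_nonneg:
  assumes "strict_mono_on {0..} \<Phi>"
  shows "0 \<le> ext_inverse \<Phi> s"
proof (cases "s \<in> \<Phi> ` {0..}")
  case True
  then obtain d where "d \<ge> 0" "s = \<Phi> d"
    by auto
  then show ?thesis
    by (simp add: ext_inverse_apply[OF assms])
qed (simp add: ext_inverse_def)

text \<open>
  Young's inequality \<open>\<alpha> t \<le> \<Psi>(\<alpha>) + \<Phi>\<^sup>-\<^sup>1(t)\<close> is used twice, with \<open>t = \<Phi> d\<close> to absorb \<open>d\<close> and with
  \<open>t = s\<close>; this is where the factor \<open>2\<close> comes from. If \<open>\<Psi>(\<alpha>)\<close> is infinite or \<open>s\<close> is outside the
  range of \<open>\<Phi>\<close>, the right-hand side is \<open>\<infinity>\<close>, because both of its summands are nonnegative.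
\<close>

lemma conjugate_rate_bound:
  assumes \<Phi>: "strict_mono_on {0..} \<Phi>" "\<And>s. s \<ge> 0 \<Longrightarrow> \<Phi> s \<ge> 0" "\<Phi> 0 = 0"
    and "d \<ge> 0" "s \<ge> 0"
  shows "ereal (\<alpha> * (\<Phi> d + s) - d) \<le> 2 * convex_conjugate (ext_inverse \<Phi>) \<alpha> + ext_inverse \<Phi> s"
proof -
  define \<Psi> where "\<Psi> = convex_conjugate (ext_inverse \<Phi>) \<alpha>"
  have young: "ereal (\<alpha> * t) - ext_inverse \<Phi> t \<le> \<Psi>" if "t \<ge> 0" for t
    unfolding \<Psi>_def convex_conjugate_def using that by (intro SUP_upper) auto
  have d: "ereal (\<alpha> * \<Phi> d - d) \<le> \<Psi>"
    using young[of "\<Phi> d"] \<Phi>(2) \<open>d \<ge> 0\<close> by (simp add: ext_inverse_apply[OF \<Phi>(1)])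
  have "0 \<le> \<Psi>"
    using young[of 0] ext_inverse_apply[OF \<Phi>(1), of 0] \<Phi>(3) by (simp add: zero_ereal_def)
  show ?thesis
  proof (cases "\<Psi> = \<infinity> \<or> ext_inverse \<Phi> s = \<infinity>")
    case True
    then show ?thesis
      using \<open>0 \<le> \<Psi>\<close> ext_inverse_nonneg[OF \<Phi>(1), of s] unfolding \<Psi>_def[symmetric]
      by (cases \<Psi>; cases "ext_inverse \<Phi> s") auto
  next
    case False
    then obtain P x where "\<Psi> = ereal P" "ext_inverse \<Phi> s = ereal x"
      using \<open>0 \<le> \<Psi>\<close> ext_inverse_nonneg[OF \<Phi>(1), of s]
      by (cases \<Psi>; cases "ext_inverse \<Phi> s") auto
    moreover from this have "2 * \<Psi> = ereal (2 * P)"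
      by (simp flip: times_ereal.simps(1))
    ultimately show ?thesis
      using d young[OF \<open>s \<ge> 0\<close>] unfolding \<Psi>_def[symmetric]
      by (simp add: algebra_simps)
  qed
qed


section \<open>The convergence rate\<close>

theorem theorem5p4:
  fixes \<Omega> \<Gamma> :: "(real ^ 2) set"
    and A :: "(real ^ 2 \<Rightarrow> real) \<Rightarrow> (real ^ 2 \<Rightarrow> real)"
    and f ud pd :: "real ^ 2 \<Rightarrow> real"
    and R :: "(real ^ 2 \<Rightarrow> real) \<Rightarrow> ereal"
    and u :: "real \<Rightarrow> (real ^ 2 \<Rightarrow> real)"
    and \<Phi> :: "real \<Rightarrow> real"
    and c\<^sub>1 c\<^sub>2 m \<gamma> :: real
  assumes Omega: "bounded \<Omega>" "\<Omega> \<in> sets lebesgue"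
    and Gamma: "bounded \<Gamma>" "\<Gamma> \<in> sets lebesgue"
    and A_linear: "linear_operator (lebesgue_on \<Omega>) (lebesgue_on \<Gamma>) A"
    and A_compact: "compact_operator (lebesgue_on \<Omega>) (lebesgue_on \<Gamma>) A"
    and A_ill_posed: "ill_posed (lebesgue_on \<Omega>) (lebesgue_on \<Gamma>) A"
    and f_Linf: "f \<in> Linf (lebesgue_on \<Gamma>)"
    and c_pos: "c\<^sub>1 > 0" "c\<^sub>2 > 0"
    and f_bounds: "AE t in lebesgue_on \<Gamma>. c\<^sub>1 \<le> f t \<and> f t \<le> c\<^sub>2"
    and R_proper: "proper_functional (lebesgue_on \<Omega>) R"
    and R_convex: "convex_functional (lebesgue_on \<Omega>) R"
    and R_lsc: "lsc_functional (lebesgue_on \<Omega>) R"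
    and ud_argmin:
      "is_arg_min R (\<lambda>v. v \<in> L1 (lebesgue_on \<Omega>) \<and> (AE t in lebesgue_on \<Gamma>. A v t = f t)) ud"
    and u_argmin: "\<And>\<alpha>. \<alpha> > 0 \<Longrightarrow>
      is_arg_min (\<lambda>v. ereal (1 / \<alpha>) * KL (lebesgue_on \<Gamma>) f (A v) + R v)
        (\<lambda>v. v \<in> L1 (lebesgue_on \<Omega>)) (u \<alpha>)"
    and u0: "\<exists>u\<^sub>0\<in>L1 (lebesgue_on \<Omega>).
      KL (lebesgue_on \<Gamma>) f (A u\<^sub>0) < \<infinity> \<and> R u\<^sub>0 < \<infinity> \<and>
      continuous_at_Linf (lebesgue_on \<Gamma>) (KL (lebesgue_on \<Gamma>) f) (A u\<^sub>0)"
    and Au_E: "\<And>\<alpha>. \<alpha> > 0 \<Longrightarrow> A (u \<alpha>) \<in> E_set (lebesgue_on \<Gamma>)"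
    and m_pos: "m > 0"
    and m_bound: "\<exists>\<alpha>\<^sub>0>0. ereal m \<le> (INF \<alpha>\<in>{0<..<\<alpha>\<^sub>0}. ess_inf (lebesgue_on \<Gamma>) (A (u \<alpha>)))"
    and pd_Linf: "pd \<in> Linf (lebesgue_on \<Gamma>)"
    and pd_source:
      "adjoint_op A (as_functional (lebesgue_on \<Gamma>) pd) \<in> subdifferential (lebesgue_on \<Omega>) R ud"
    and Phi_nonneg: "\<And>s. s \<ge> 0 \<Longrightarrow> \<Phi> s \<ge> 0"
    and Phi_strict_mono: "strict_mono_on {0..} \<Phi>"
    and Phi_cont: "continuous_on {0..} \<Phi>"
    and Phi_concave: "concave_on {0..} \<Phi>"
    and Phi_zero: "\<Phi> 0 = 0"
    and VSC: "\<And>p. p \<in> Linf (lebesgue_on \<Gamma>) \<Longrightarrow>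
      ereal (\<integral>t. f t * pd t * (pd t - p t) \<partial>lebesgue_on \<Gamma>)
        \<le> ext_apply \<Phi>
            (bregman_dual (fenchel_conjugate (lebesgue_on \<Omega>) R) ud
              (adjoint_op A (as_functional (lebesgue_on \<Gamma>) p))
              (adjoint_op A (as_functional (lebesgue_on \<Gamma>) pd)))"
    and gamma: "\<gamma> = 2 * m / 3"
  shows "\<exists>\<alpha>\<^sub>1>0. \<forall>\<alpha>. 0 < \<alpha> \<and> \<alpha> < \<alpha>\<^sub>1 \<longrightarrow>
    bregman R (adjoint_op A (as_functional (lebesgue_on \<Gamma>) pd)) (u \<alpha>) ud
      \<le> 2 * convex_conjugate (ext_inverse \<Phi>) \<alpha>
        + ext_inverse \<Phi>
            (\<alpha>\<^sup>2 * ((norm_2 (lebesgue_on \<Gamma>) (\<lambda>t. f t * (pd t)\<^sup>2))\<^sup>2 / (4 * \<gamma>)))"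
proof -
  let ?N = "lebesgue_on \<Gamma>" and ?M = "lebesgue_on \<Omega>"
  have N: "finite_measure ?N"
    using Gamma by (intro finite_measure_lebesgue_on bounded_set_imp_lmeasurable)
  obtain \<alpha>\<^sub>0 where "\<alpha>\<^sub>0 > 0" and "ereal m \<le> (INF \<alpha>\<in>{0<..<\<alpha>\<^sub>0}. ess_inf ?N (A (u \<alpha>)))"
    using m_bound by auto
  then have lower: "AE t in ?N. m \<le> A (u \<alpha>) t" if "0 < \<alpha>" "\<alpha> < \<alpha>\<^sub>0" for \<alpha>
    using that by (intro AE_ge_of_le_ess_inf) (auto simp: le_INF_iff)
  obtain C where "C \<ge> 0" and C: "AE t in ?N. \<bar>pd t\<bar> \<le> C"
    using pd_Linf by (auto simp: mem_Linf_iff)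
  \<comment> \<open>The second bound makes \<open>\<alpha> \<bar>p\<^sup>\<dagger>\<bar> \<le> 1 / 10\<close> almost everywhere.\<close>
  define \<alpha>\<^sub>1 where "\<alpha>\<^sub>1 = min \<alpha>\<^sub>0 (1 / (10 * (C + 1)))"
  have "\<alpha>\<^sub>1 > 0"
    using \<open>\<alpha>\<^sub>0 > 0\<close> \<open>C \<ge> 0\<close> by (simp add: \<alpha>\<^sub>1_def)
  have ud: "ud \<in> L1 ?M" and Aud: "AE t in ?N. A ud t = f t"
    using ud_argmin by (auto simp: is_arg_min_def)
  define \<eta> where "\<eta> = adjoint_op A (as_functional ?N pd)"
  obtain r' where Rud: "R ud = ereal r'"
    using pd_source by (cases "R ud") (auto simp: subdifferential_def)
  have \<eta>_diff: "\<eta> (\<lambda>t. v t - w t) = \<eta> v - \<eta> w" if "v \<in> L1 ?M" "w \<in> L1 ?M" for v w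
    unfolding \<eta>_def adjoint_op_def by (rule as_functional_diff(1)[OF N A_linear pd_Linf that])
  have \<eta>_sub: "R ud + ereal (\<eta> v - \<eta> ud) \<le> R v" if "v \<in> L1 ?M" for v
    using pd_source that \<eta>_diff[OF that ud] by (auto simp: subdifferential_def \<eta>_def)
  have "bregman R \<eta> (u \<alpha>) ud
      \<le> 2 * convex_conjugate (ext_inverse \<Phi>) \<alpha>
        + ext_inverse \<Phi> (\<alpha>\<^sup>2 * ((norm_2 ?N (\<lambda>t. f t * (pd t)\<^sup>2))\<^sup>2 / (4 * \<gamma>)))"
    if \<alpha>: "0 < \<alpha>" "\<alpha> < \<alpha>\<^sub>1" for \<alpha>
  proof -
    define z where "z = A (u \<alpha>)"
    have "\<alpha> < \<alpha>\<^sub>0"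
      using \<alpha> by (simp add: \<alpha>\<^sub>1_def)
    note min = u_argmin[OF \<alpha>(1)] and zm = lower[OF \<alpha>(1) \<open>\<alpha> < \<alpha>\<^sub>0\<close>, folded z_def]
    have u: "u \<alpha> \<in> L1 ?M"
      using min by (simp add: is_arg_min_def)
    have zL: "z \<in> Linf ?N" and AudL: "A ud \<in> Linf ?N"
      unfolding z_def by (rule linear_operator_Linf[OF A_linear u] linear_operator_Linf[OF A_linear ud])+
    have noMInf: "\<forall>v\<in>L1 ?M. R v \<noteq> - \<infinity>"
      using R_proper unfolding proper_functional_def by (elim conjE)
    \<comment> \<open>The objective is finite at \<open>u\<^sub>0\<close>, so it is finite at the minimizer, and neither of its
      terms can be \<open>- \<infinity>\<close>.\<close>
    obtain r where Ru: "R (u \<alpha>) = ereal r"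
    proof -
      obtain u\<^sub>0 where u\<^sub>0: "u\<^sub>0 \<in> L1 ?M" "KL ?N f (A u\<^sub>0) < \<infinity>" "R u\<^sub>0 < \<infinity>"
        using u0 by auto
      have KL_noMInf: "KL ?N f w \<noteq> - \<infinity>" for w
        by (auto simp: KL_def)
      have "ereal (1 / \<alpha>) * KL ?N f (A (u \<alpha>)) + R (u \<alpha>) \<le> ereal (1 / \<alpha>) * KL ?N f (A u\<^sub>0) + R u\<^sub>0"
        using min u\<^sub>0(1) unfolding is_arg_min_def by (meson not_le)
      also have "\<dots> < \<infinity>"
        using u\<^sub>0 KL_noMInf[of "A u\<^sub>0"] by (cases "KL ?N f (A u\<^sub>0)"; cases "R u\<^sub>0") auto
      finally have "R (u \<alpha>) \<noteq> \<infinity>"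
        by auto
      with that noMInf u show thesis
        by (cases "R (u \<alpha>)") auto
    qed
    \<comment> \<open>The dual solution: \<open>- 1 / \<alpha>\<close> times the gradient of the Kullback-Leibler functional at \<open>z\<close>.\<close>
    define p where "p = (\<lambda>t. (f t / z t - 1) / \<alpha>)"
    have pL: "p \<in> Linf ?N"
    proof -
      have "(\<lambda>t. (1 / \<alpha>) * (f t / z t - 1)) \<in> Linf ?N"
        by (intro Linf_intros Linf_divide[OF _ _ m_pos zm] f_Linf zL)
      then show ?thesis
        by (simp add: p_def)
    qed
    have fp: "AE t in ?N. f t = z t * (1 + \<alpha> * p t)"
      using zm by eventually_elim (use m_pos \<alpha> in \<open>simp add: p_def field_simps\<close>)
    define \<xi> where "\<xi> = adjoint_op A (as_functional ?N p)"
    have \<xi>_sub: "R (u \<alpha>) + ereal (\<xi> v - \<xi> (u \<alpha>)) \<le> R v" if "v \<in> L1 ?M" for v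
    proof -
      have "\<xi> v - \<xi> (u \<alpha>) = (\<integral>t. p t * (A v t - A (u \<alpha>) t) \<partial>?N)"
        unfolding \<xi>_def adjoint_op_def by (rule as_functional_diff(2)[OF N A_linear pL that u])
      then show ?thesis
        using KL_minimizer_subgradient[OF N A_linear f_Linf c_pos(1) f_bounds R_convex noMInf \<alpha>(1)
            min Ru m_pos zm[unfolded z_def] that]
        by (simp add: p_def z_def)
    qed
    obtain d where "d \<ge> 0" and d: "bregman_dual (fenchel_conjugate ?M R) ud \<xi> \<eta> = ereal d"
      and D: "bregman R \<eta> (u \<alpha>) ud = ereal ((\<xi> (u \<alpha>) - \<xi> ud) - (\<eta> (u \<alpha>) - \<eta> ud) - d)"
      using bregman_sum[where \<xi> = \<xi> and \<eta> = \<eta>, OF u Ru \<xi>_sub ud Rud \<eta>_sub \<eta>_diff[OF u ud]] by metis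
    define s where "s = \<alpha>\<^sup>2 * ((norm_2 ?N (\<lambda>t. f t * (pd t)\<^sup>2))\<^sup>2 / (4 * \<gamma>))"
    have s_eq: "s = (\<integral>t. \<alpha>\<^sup>2 * ((f t * (pd t)\<^sup>2)\<^sup>2 / (4 * (2 * m / 3))) \<partial>?N)"
      by (simp add: s_def norm_2_def gamma)
    have "s \<ge> 0"
      using m_pos by (simp add: s_def gamma)
    have vsc: "(\<integral>t. f t * pd t * (pd t - p t) \<partial>?N) \<le> \<Phi> d"
      using VSC[OF pL] d by (simp add: ext_apply_def \<xi>_def \<eta>_def)
    have "(\<xi> (u \<alpha>) - \<xi> ud) - (\<eta> (u \<alpha>) - \<eta> ud)
        = (\<integral>t. p t * (z t - A ud t) \<partial>?N) - (\<integral>t. pd t * (z t - A ud t) \<partial>?N)"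
      using as_functional_diff(2)[OF N A_linear _ u ud] pL pd_Linf
      by (simp add: \<xi>_def \<eta>_def adjoint_op_def z_def)
    also have "\<dots> = (\<integral>t. p t * (z t - A ud t) - pd t * (z t - A ud t) \<partial>?N)"
      by (intro Bochner_Integration.integral_diff[symmetric] finite_measure.integrable_Linf[OF N]
          Linf_intros pL pd_Linf zL AudL)
    also have "\<dots> \<le> (\<integral>t. \<alpha> * (f t * pd t * (pd t - p t)
        + \<alpha>\<^sup>2 * ((f t * (pd t)\<^sup>2)\<^sup>2 / (4 * (2 * m / 3)))) \<partial>?N)"
    proof (rule integral_mono_AE)
      show "integrable ?N (\<lambda>t. p t * (z t - A ud t) - pd t * (z t - A ud t))"
        by (intro finite_measure.integrable_Linf[OF N] Linf_intros pL pd_Linf zL AudL)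
      show "integrable ?N (\<lambda>t. \<alpha> * (f t * pd t * (pd t - p t)
          + \<alpha>\<^sup>2 * ((f t * (pd t)\<^sup>2)\<^sup>2 / (4 * (2 * m / 3)))))"
        unfolding divide_inverse
        by (intro finite_measure.integrable_Linf[OF N] Linf_intros pL pd_Linf f_Linf)
      show "AE t in ?N. p t * (z t - A ud t) - pd t * (z t - A ud t) \<le> \<alpha> * (f t * pd t * (pd t - p t)
          + \<alpha>\<^sup>2 * ((f t * (pd t)\<^sup>2)\<^sup>2 / (4 * (2 * m / 3))))"
        using fp zm C Aud
      proof eventually_elim
        case (elim t)
        have "\<alpha> * \<bar>pd t\<bar> \<le> (1 / (10 * (C + 1))) * (C + 1)"
          using \<alpha> elim(3) \<open>C \<ge> 0\<close> by (intro mult_mono) (auto simp: \<alpha>\<^sub>1_def)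
        also have "\<dots> = 1 / 10"
          using \<open>C \<ge> 0\<close> by (simp add: divide_simps)
        finally have "\<alpha> * \<bar>pd t\<bar> \<le> 1 / 10" .
        from KL_dual_pairing_bound[OF m_pos elim(2) \<alpha>(1) elim(1) this]
        have "\<alpha> * (z t * p t * (pd t - p t)) \<le> \<alpha> * (f t * pd t * (pd t - p t)
            + \<alpha>\<^sup>2 * ((f t * (pd t)\<^sup>2)\<^sup>2 / (4 * (2 * m / 3))))"
          using \<alpha>(1) by (intro mult_left_mono) auto
        moreover have "p t * (z t - A ud t) - pd t * (z t - A ud t) = \<alpha> * (z t * p t * (pd t - p t))"
          unfolding elim(4) elim(1) by (simp add: algebra_simps)
        ultimately show ?case
          by simp
      qed
    qed
    also have "\<dots> = \<alpha> * ((\<integral>t. f t * pd t * (pd t - p t) \<partial>?N) + s)"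
    proof -
      have "integrable ?N (\<lambda>t. f t * pd t * (pd t - p t))"
        "integrable ?N (\<lambda>t. \<alpha>\<^sup>2 * ((f t * (pd t)\<^sup>2)\<^sup>2 / (4 * (2 * m / 3))))"
        unfolding divide_inverse
        by (intro finite_measure.integrable_Linf[OF N] Linf_intros pL pd_Linf f_Linf)+
      then show ?thesis
        unfolding s_eq by (subst integral_mult_right_zero) (simp only: Bochner_Integration.integral_add)
    qed
    also have "\<dots> \<le> \<alpha> * (\<Phi> d + s)"
      using vsc \<alpha>(1) by (intro mult_left_mono) auto
    finally have "bregman R \<eta> (u \<alpha>) ud \<le> ereal (\<alpha> * (\<Phi> d + s) - d)"
      by (simp add: D)
    also have "\<dots> \<le> 2 * convex_conjugate (ext_inverse \<Phi>) \<alpha> + ext_inverse \<Phi> s"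
      by (rule conjugate_rate_bound[OF Phi_strict_mono Phi_nonneg Phi_zero \<open>d \<ge> 0\<close> \<open>s \<ge> 0\<close>])
    finally show ?thesis
      by (simp add: s_def)
  qed
  with \<open>\<alpha>\<^sub>1 > 0\<close> show ?thesis
    unfolding \<eta>_def by blast
qed

end
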